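(* Let $(\Omega,\mathcal{F})$ be a standard measurable space, $T:\Omega\to\Omega$ a measurable transformation and $V$ a $T$-invariant upper probability. Let $\{f_n\}_{n\in\mathbb{N}}$ be $\mathcal{F}$-measurable functions such that (i) there exists $\lambda>0$ with $-\lambda n\le f_n(\omega)\le\lambda n$ for all $n\in\mathbb{N}$, $\omega\in\Omega$; (ii) for all $k,n\in\mathbb{N}$, $f_{n+k}\le f_n+f_k\circ T^n$ $V$-a.s. Then there exists a bounded $\mathcal{I}$-measurable function $f^*:\Omega\to\mathbb{R}$ such that $\lim_{n\to\infty}\frac{1}{n}f_n(\omega)=f^*(\omega)$ for $V$-a.s. $\omega\in\Omega$. If, in addition, $V$ is ergodic, then $f^*$ is constant $V$-a.s.
   Context: A measurable space is standard if isomorphic to a complete separable metric space with its Borel $\sigma$-algebra. A capacity is a monotone map $\mu:\mathcal{F}\to[0,1]$ with $\mu(\emptyset)=0,\mu(\Omega)=1$. An upper probability is a capacity $V$ with $V(A)=\max_{P\in\Lambda}P(A)$ for a weak* (setwise convergence) compact set $\Lambda$ of probabilities. $V$ is $T$-invariant if $V(T^{-1}A)=V(A)$. $\mathcal{I}=\{A\in\mathcal{F}:T^{-1}A=A\}$. $V$ is ergodic if for every $B\in\mathcal{I}$, $V(B)\in\{0,1\}$ and ($V(B)=0$ or $V(B^c)=0$). A property holds $V$-a.s. if it holds on a set $A\in\mathcal{F}$ with $V(A^c)=0$. *)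

theory Defs
  imports "HOL-Probability.Probability"
begin

definition metric_borel :: "'a metric \<Rightarrow> 'a measure" where
  "metric_borel m = sigma (mspace m) {U. openin (mtopology_of m) U}"

definition standard_space :: "'a measure \<Rightarrow> bool" where
  "standard_space M \<longleftrightarrow>
     (\<exists>(m::'a metric) f g. mcomplete_of m \<and> separable_space (mtopology_of m) \<and>
        f \<in> M \<rightarrow>\<^sub>M metric_borel m \<and> g \<in> metric_borel m \<rightarrow>\<^sub>M M \<and>
        (\<forall>x\<in>space M. g (f x) = x) \<and> (\<forall>y\<in>mspace m. f (g y) = y))"

definition capacity :: "'a measure \<Rightarrow> ('a set \<Rightarrow> real) \<Rightarrow> bool" where
  "capacity M V \<longleftrightarrow>
     V {} = 0 \<and> V (space M) = 1 \<and>
     (\<forall>A\<in>sets M. \<forall>B\<in>sets M. A \<subseteq> B \<longrightarrow> V A \<le> V B) \<and>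
     (\<forall>A\<in>sets M. 0 \<le> V A \<and> V A \<le> 1)"

definition probs_on :: "'a measure \<Rightarrow> 'a measure set" where
  "probs_on M = {P. prob_space P \<and> sets P = sets M}"

(* compactness w.r.t. the topology of setwise convergence (the initial topology of the
   maps P \<mapsto> P(A), A \<in> F); realised via the (injective) embedding
   P \<mapsto> (A \<mapsto> P(A)) into the product topology on real^F *)
definition setwise_compact :: "'a measure \<Rightarrow> 'a measure set \<Rightarrow> bool" where
  "setwise_compact M \<Lambda> \<longleftrightarrow>
     compactin (powertop_real (sets M)) ((\<lambda>P. restrict (measure P) (sets M)) ` \<Lambda>)"

definition upper_probability :: "'a measure \<Rightarrow> ('a set \<Rightarrow> real) \<Rightarrow> bool" where
  "upper_probability M V \<longleftrightarrow> capacity M V \<and>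
     (\<exists>\<Lambda>. \<Lambda> \<subseteq> probs_on M \<and> setwise_compact M \<Lambda> \<and>
        (\<forall>A\<in>sets M. (\<exists>P\<in>\<Lambda>. measure P A = V A) \<and> (\<forall>P\<in>\<Lambda>. measure P A \<le> V A)))"

definition T_invariant_cap :: "'a measure \<Rightarrow> ('a \<Rightarrow> 'a) \<Rightarrow> ('a set \<Rightarrow> real) \<Rightarrow> bool" where
  "T_invariant_cap M T V \<longleftrightarrow> (\<forall>A\<in>sets M. V (T -` A \<inter> space M) = V A)"

definition inv_sets :: "'a measure \<Rightarrow> ('a \<Rightarrow> 'a) \<Rightarrow> 'a set set" where
  "inv_sets M T = {A\<in>sets M. T -` A \<inter> space M = A}"

definition inv_measurable :: "'a measure \<Rightarrow> ('a \<Rightarrow> 'a) \<Rightarrow> ('a \<Rightarrow> real) \<Rightarrow> bool" where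
  "inv_measurable M T f \<longleftrightarrow> (\<forall>B\<in>sets borel. f -` B \<inter> space M \<in> inv_sets M T)"

definition ergodic_cap :: "'a measure \<Rightarrow> ('a \<Rightarrow> 'a) \<Rightarrow> ('a set \<Rightarrow> real) \<Rightarrow> bool" where
  "ergodic_cap M T V \<longleftrightarrow>
     (\<forall>B\<in>inv_sets M T. (V B = 0 \<or> V B = 1) \<and> (V B = 0 \<or> V (space M - B) = 0))"

definition V_as :: "'a measure \<Rightarrow> ('a set \<Rightarrow> real) \<Rightarrow> ('a \<Rightarrow> bool) \<Rightarrow> bool" where
  "V_as M V P \<longleftrightarrow> (\<exists>A\<in>sets M. V (space M - A) = 0 \<and> (\<forall>\<omega>\<in>A. P \<omega>))"

end

theory Submission
  imports Defs
begin

text \<open>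
  Compactness of \<open>\<Lambda>\<close> makes \<open>V\<close> continuous from above at the empty set.
  Two consequences replace an invariant measure. First, the preimages of a wandering set are
  disjoint and all have the same capacity, so wandering sets are \<open>V\<close>-null. Subadditivity gives
  \<open>h \<le> h \<circ> T\<close> for \<open>h = liminf f\<^sub>n / n\<close>, hence \<open>h = h \<circ> T\<close> up to a \<open>V\<close>-null set.
  Second, \<open>P (T\<^sup>-\<^sup>i A) \<le> V A\<close> for all \<open>P \<in> \<Lambda>\<close> and all \<open>i\<close>, so a greedy covering of orbits yields the
  maximal inequality \<open>\<delta> P (D) \<le> V A\<close>, where \<open>D\<close> is the set of points visiting \<open>A\<close> with frequency
  above \<open>\<delta>\<close>.
  The same covering, in the manner of Katznelson and Weiss, bounds \<open>f\<^sub>n\<close> by \<open>n (h + \<epsilon>)\<close> plus an error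
  proportional to the number of visits to the set \<open>A\<^sub>L\<close> where no \<open>m \<le> L\<close> satisfies \<open>f\<^sub>m \<le> m (h + \<epsilon>)\<close>.
  Since \<open>A\<^sub>L\<close> decreases to the empty set, this frequency is \<open>V\<close>-almost surely below any \<open>\<delta>\<close> for large \<open>L\<close>.
\<close>

section \<open>Greedy covering for subadditive processes\<close>

text \<open>
  Cut \<open>{i..<i + n}\<close> greedily from the left: from a good position jump to the end of a block of
  length at most \<open>L\<close> on which \<open>F\<close> is below \<open>c\<close> times the length, from a bad one
  (\<open>b \<ge> 1\<close>) advance by one.
\<close>

lemma subadditive_covering:
  fixes F :: "nat \<Rightarrow> nat \<Rightarrow> real" and b :: "nat \<Rightarrow> real"
  assumes sub: "\<And>i n k. F i (n + k) \<le> F i n + F (i + n) k"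
    and up: "\<And>i n. F i n \<le> lam * real n"
    and K: "K \<ge> 0" "lam - c \<le> K"
    and b0: "\<And>j. b j \<ge> 0"
    and good: "\<And>i. b i < 1 \<Longrightarrow> \<exists>m\<in>{1..L}. F i m \<le> c * real m"
  shows "F i n \<le> c * real n + K * (\<Sum>j<n. b (i + j)) + K * real L"
proof (induction n arbitrary: i rule: less_induct)
  case (less n)
  have sum0: "K * (\<Sum>j<n. b (i + j)) \<ge> 0"
    using K b0 by (simp add: sum_nonneg)
  show ?case
  proof (cases "n \<le> L")
    \<comment> \<open>The recursion ends on a leftover of length at most \<open>L\<close>. Each of
      its steps costs at most \<open>K\<close> above \<open>c\<close>, so \<open>K * L\<close> pays
      for it, and only once.\<close>
    case True
    have "F i n \<le> lam * real n" by (rule up)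
    also have "\<dots> \<le> (c + K) * real n"
      using K by (intro mult_right_mono) auto
    also have "\<dots> \<le> c * real n + K * real L"
      using True K by (simp add: distrib_right mult_left_mono)
    finally show ?thesis using sum0 by linarith
  next
    case False
    \<comment> \<open>A good first block fits because its length is at most \<open>L < n\<close>. At
      a bad position the choice is \<open>m = 1\<close>, and \<open>b i \<ge> 1\<close> pays the
      excess \<open>K\<close>.\<close>
    have "\<exists>m\<in>{1..n}. F i m \<le> c * real m + K * (\<Sum>j<m. b (i + j))"
    proof (cases "b i < 1")
      case True
      then obtain m where m: "m \<in> {1..L}" "F i m \<le> c * real m"
        using good by blast
      have "K * (\<Sum>j<m. b (i + j)) \<ge> 0"
        using K b0 by (simp add: sum_nonneg)
      with m False show ?thesis by (intro bexI[of _ m]) auto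
    next
      case b1: False
      have "F i 1 \<le> lam" using up[of i 1] by simp
      also have "\<dots> \<le> c + K" using K by simp
      also have "\<dots> \<le> c + K * b i"
        using b1 K mult_left_mono[of 1 "b i" K] by simp
      finally show ?thesis using False by (intro bexI[of _ 1]) auto
    qed
    then obtain m where m: "1 \<le> m" "m \<le> n"
      "F i m \<le> c * real m + K * (\<Sum>j<m. b (i + j))" by auto
    have "F i n \<le> F i m + F (i + m) (n - m)"
      using sub[of i m "n - m"] m by simp
    also have "F (i + m) (n - m) \<le>
        c * real (n - m) + K * (\<Sum>j<n-m. b (i + m + j)) + K * real L"
      using less.IH[of "n - m" "i + m"] m by simp
    also have "(\<Sum>j<n-m. b (i + m + j)) = (\<Sum>j<n. b (i + j)) - (\<Sum>j<m. b (i + j))"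
    proof -
      have "(\<Sum>j<m + k. b (i + j)) = (\<Sum>j<m. b (i + j)) + (\<Sum>j<k. b (i + m + j))" for k
        by (induction k) (simp_all add: add.assoc)
      from this[of "n - m"] show ?thesis using m by simp
    qed
    finally show ?thesis
      using m by (simp add: of_nat_diff algebra_simps)
  qed
qed

section \<open>Real-valued lower limits\<close>

text \<open>The function is total: where the lower limit is infinite, its value is the default 0.
  Shift invariance holds in every case, whereas comparison with the sequence itself is made under a
  bound.\<close>

definition real_liminf :: "(nat \<Rightarrow> real) \<Rightarrow> real" where
  "real_liminf u = real_of_ereal (liminf (\<lambda>n. ereal (u n)))"

lemma borel_measurable_real_liminf [measurable (raw)]:
  assumes [measurable]: "\<And>n. (\<lambda>x. u x n) \<in> borel_measurable M"
  shows "(\<lambda>x. real_liminf (u x)) \<in> borel_measurable M"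
  unfolding real_liminf_def by measurable

lemma ereal_real_liminf:
  assumes "\<And>n. \<bar>u n\<bar> \<le> C"
  shows "ereal (real_liminf u) = liminf (\<lambda>n. ereal (u n))" "\<bar>real_liminf u\<bar> \<le> C"
proof -
  have "ereal (- C) \<le> liminf (\<lambda>n. ereal (u n))"
    using assms by (intro Liminf_bounded always_eventually) (auto simp: abs_le_iff minus_le_iff)
  moreover have "liminf (\<lambda>n. ereal (u n)) \<le> ereal C"
    using assms by (intro Liminf_le always_eventually) (auto simp: abs_le_iff)
  ultimately show "ereal (real_liminf u) = liminf (\<lambda>n. ereal (u n))" "\<bar>real_liminf u\<bar> \<le> C"
    unfolding real_liminf_def
    by (cases "liminf (\<lambda>n. ereal (u n))"; auto)+
qed

lemma eventually_gt_real_liminf: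
  assumes "\<And>n. \<bar>u n\<bar> \<le> C" "e > 0"
  shows "eventually (\<lambda>n. real_liminf u - e < u n) sequentially"
proof -
  have "ereal (real_liminf u - e) < liminf (\<lambda>n. ereal (u n))"
    using assms(2) unfolding ereal_real_liminf(1)[OF assms(1), symmetric] by simp
  from less_LiminfD[OF this] show ?thesis by simp
qed

lemma frequently_less_real_liminf:
  assumes "\<And>n. \<bar>u n\<bar> \<le> C" "e > 0"
  shows "\<exists>n\<ge>N. u n < real_liminf u + e"
proof (rule ccontr)
  assume "\<not> ?thesis"
  then have "eventually (\<lambda>n. ereal (real_liminf u + e) \<le> ereal (u n)) sequentially"
    by (auto simp: eventually_sequentially not_less)
  then have "ereal (real_liminf u + e) \<le> liminf (\<lambda>n. ereal (u n))"
    by (rule Liminf_bounded)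
  with assms(2) show False
    unfolding ereal_real_liminf(1)[OF assms(1), symmetric] by simp
qed

lemma real_liminf_Suc: "real_liminf (\<lambda>n. u (Suc n)) = real_liminf u"
  using liminf_shift[of "\<lambda>n. ereal (u n)"] by (simp add: real_liminf_def)

lemma real_liminf_const: "real_liminf (\<lambda>n. c) = c"
  by (simp add: real_liminf_def Liminf_const)

text \<open>A null sequence does not change a lower limit. The index shift on the left matches
  \<open>f (n + 1) x\<close> with \<open>f n (T x)\<close> in the proof that the lower limit does
  not decrease along \<open>T\<close>.\<close>

lemma real_liminf_le_of_null_diff:
  assumes "\<And>n. \<bar>u n\<bar> \<le> C" "\<And>n. \<bar>v n\<bar> \<le> C"
    and le: "\<And>n. u (Suc n) \<le> v n + d n" and d: "d \<longlonglongrightarrow> 0"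
  shows "real_liminf u \<le> real_liminf v"
proof -
  have "liminf (\<lambda>n. ereal (u n)) = liminf (\<lambda>n. ereal (u (Suc n)))"
    using liminf_shift[of "\<lambda>n. ereal (u n)"] by simp
  also have "\<dots> \<le> liminf (\<lambda>n. ereal (d n) + ereal (v n))"
    using le by (intro Liminf_mono always_eventually) (auto simp: add.commute)
  also have "\<dots> = 0 + liminf (\<lambda>n. ereal (v n))"
    using d by (intro ereal_liminf_lim_add) (auto simp: zero_ereal_def)
  finally show ?thesis
    unfolding ereal_real_liminf(1)[OF assms(1), symmetric]
      ereal_real_liminf(1)[OF assms(2), symmetric] by simp
qed

section \<open>Upper probabilities: continuity and quasi-sure statements\<close>

text \<open>Fixing a representing family \<open>\<Lambda>\<close> lets statements about
  \<open>V\<close> be proved almost everywhere under each \<open>P \<in> \<Lambda>\<close>.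
  Monotonicity of \<open>V\<close> is derived from the attained maximum.\<close>

locale invariant_upper_probability =
  fixes M :: "'a measure" and T :: "'a \<Rightarrow> 'a" and V :: "'a set \<Rightarrow> real"
    and \<Lambda> :: "'a measure set"
  assumes T_meas [measurable]: "T \<in> M \<rightarrow>\<^sub>M M"
    and \<Lambda>_probs: "\<Lambda> \<subseteq> probs_on M"
    and \<Lambda>_compact: "setwise_compact M \<Lambda>"
    and V_attained: "A \<in> sets M \<Longrightarrow> \<exists>P\<in>\<Lambda>. measure P A = V A"
    and measure_le_V: "P \<in> \<Lambda> \<Longrightarrow> A \<in> sets M \<Longrightarrow> measure P A \<le> V A"
    and V_invariant: "A \<in> sets M \<Longrightarrow> V (T -` A \<inter> space M) = V A"
begin

lemma \<Lambda>_prob_space: "P \<in> \<Lambda> \<Longrightarrow> prob_space P"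
  and sets_\<Lambda>: "P \<in> \<Lambda> \<Longrightarrow> sets P = sets M"
  and space_\<Lambda>: "P \<in> \<Lambda> \<Longrightarrow> space P = space M"
  using \<Lambda>_probs sets_eq_imp_space_eq[of P M] by (auto simp: probs_on_def)

lemma V_nonneg: "A \<in> sets M \<Longrightarrow> 0 \<le> V A"
  using V_attained[of A] measure_nonneg by metis

lemma V_mono: "A \<in> sets M \<Longrightarrow> B \<in> sets M \<Longrightarrow> A \<subseteq> B \<Longrightarrow> V A \<le> V B"
proof -
  assume AB: "A \<in> sets M" "B \<in> sets M" "A \<subseteq> B"
  obtain P where P: "P \<in> \<Lambda>" "measure P A = V A" using V_attained AB by blast
  interpret prob_space P using P \<Lambda>_prob_space by blast
  have "measure P A \<le> measure P B"
    using AB P sets_\<Lambda> by (intro finite_measure_mono) auto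
  with P AB measure_le_V[of P B] show ?thesis by simp
qed

text \<open>If all \<open>V (A n)\<close> were at least \<open>e > 0\<close>, the members of
  \<open>\<Lambda>\<close> giving \<open>A n\<close> mass at least \<open>e\<close> would form
  nested, closed, nonempty sets. By compactness a single \<open>P\<close> would lie in all of them,
  against its continuity from above.\<close>

lemma V_decseq_tendsto_0:
  assumes A: "\<And>n. A n \<in> sets M" and "decseq A" and empty: "(\<Inter>n. A n) = {}"
  shows "(\<lambda>n. V (A n)) \<longlonglongrightarrow> 0"
proof -
  have dec: "decseq (\<lambda>n. V (A n))"
    using A \<open>decseq A\<close> by (auto simp: decseq_def intro!: V_mono)
  have ex: "\<exists>n. V (A n) < e" if "e > 0" for e
  proof (rule ccontr)
    assume "\<not> ?thesis"
    then have ge: "\<And>n. V (A n) \<ge> e" by (simp add: not_less)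
    define X where "X = powertop_real (sets M)"
    define K where "K = (\<lambda>P. restrict (measure P) (sets M)) ` \<Lambda>"
    define C where "C n = {x \<in> topspace X. x (A n) \<in> {e..}} \<inter> K" for n
    have K: "compactin X K" using \<Lambda>_compact by (simp add: setwise_compact_def K_def X_def)
    have "(\<Inter>n. C n) \<noteq> {}"
    proof (rule compact_space_imp_nest)
      show "compact_space (subtopology X K)" using K by (simp add: compact_space_subtopology)
      fix n
      have "continuous_map X euclideanreal (\<lambda>x. x (A n))"
        unfolding X_def using A by (intro continuous_map_product_projection) auto
      then have "closedin X {x \<in> topspace X. x (A n) \<in> {e..}}"
        by (rule closedin_continuous_map_preimage) auto
      then show "closedin (subtopology X K) (C n)"
        unfolding C_def closedin_subtopology by blast
      obtain P where P: "P \<in> \<Lambda>" "measure P (A n) = V (A n)" using V_attained A by blast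
      then have "restrict (measure P) (sets M) \<in> C n"
        using ge A by (auto simp: C_def K_def X_def)
      then show "C n \<noteq> {}" by blast
    next
      have le: "y (A n) \<le> y (A m)" if y: "y \<in> K" and mn: "m \<le> n" for m n y
      proof -
        from y obtain P where P: "P \<in> \<Lambda>" "y = restrict (measure P) (sets M)"
          by (auto simp: K_def)
        interpret prob_space P using P \<Lambda>_prob_space by blast
        have "measure P (A n) \<le> measure P (A m)"
          using A P sets_\<Lambda> mn \<open>decseq A\<close>
          by (intro finite_measure_mono) (auto simp: decseq_def)
        then show ?thesis using P A by simp
      qed
      show "decseq C"
        unfolding decseq_def C_def using le by (auto intro: order_trans)
    qed
    then obtain y where y: "\<And>n. y \<in> C n" by blast
    then obtain P where P: "P \<in> \<Lambda>" "y = restrict (measure P) (sets M)"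
      by (auto simp: K_def C_def)
    interpret prob_space P using P \<Lambda>_prob_space by blast
    have "(\<lambda>n. measure P (A n)) \<longlonglongrightarrow> measure P (\<Inter>n. A n)"
      using A P sets_\<Lambda> \<open>decseq A\<close> by (intro finite_Lim_measure_decseq) auto
    moreover have "measure P (A n) \<ge> e" for n
      using y[of n] P A by (auto simp: C_def)
    ultimately have "e \<le> 0" using empty by (auto intro: LIMSEQ_le_const)
    with that show False by simp
  qed
  show ?thesis
  proof (rule LIMSEQ_I)
    fix r :: real assume "r > 0"
    then obtain N where "V (A N) < r" using ex by blast
    then have "V (A n) < r" if "n \<ge> N" for n
      using decseqD[OF dec that] by simp
    then show "\<exists>no. \<forall>n\<ge>no. norm (V (A n) - 0) < r"
      using V_nonneg A by auto
  qed
qed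

lemma iter_measurable [measurable]: "(T ^^ n) \<in> M \<rightarrow>\<^sub>M M"
  by (induction n) (auto intro: measurable_comp simp: id_def)

lemma iter_space: "x \<in> space M \<Longrightarrow> (T ^^ n) x \<in> space M"
  by (rule measurable_space[OF iter_measurable])

lemma V_iter: "A \<in> sets M \<Longrightarrow> V ((T ^^ n) -` A \<inter> space M) = V A"
proof (induction n arbitrary: A)
  case 0
  then show ?case using sets.sets_into_space by (auto simp: Int_absorb2)
next
  case (Suc n)
  have "(T ^^ Suc n) -` A \<inter> space M = (T ^^ n) -` (T -` A \<inter> space M) \<inter> space M"
    using iter_space by auto
  with Suc.IH[of "T -` A \<inter> space M"] Suc.prems V_invariant[of A] show ?case
    by (simp add: measurable_sets[OF T_meas] del: funpow.simps)
qed

text \<open>The prefix \<open>qs\<close> stands for quasi-surely, that is, almost everywhere under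
  every \<open>P \<in> \<Lambda>\<close>. Since \<open>V\<close> is the maximum over
  \<open>\<Lambda>\<close>, a set is \<open>V\<close>-null exactly when each \<open>P\<close> gives
  it mass 0.\<close>

lemma qs_iff:
  assumes [measurable]: "Measurable.pred M \<phi>"
  shows "(\<forall>P\<in>\<Lambda>. AE x in P. \<phi> x) \<longleftrightarrow> V {x\<in>space M. \<not> \<phi> x} = 0"
proof -
  have S: "{x\<in>space M. \<not> \<phi> x} \<in> sets M" by measurable
  have "(AE x in P. \<phi> x) \<longleftrightarrow> measure P {x\<in>space M. \<not> \<phi> x} = 0" if "P \<in> \<Lambda>" for P
  proof -
    interpret prob_space P using that \<Lambda>_prob_space by blast
    show ?thesis
      using AE_iff_measurable[of "{x\<in>space M. \<not> \<phi> x}" P \<phi>] S that sets_\<Lambda> space_\<Lambda>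
      by (simp add: emeasure_eq_measure)
  qed
  moreover have "(\<forall>P\<in>\<Lambda>. measure P {x\<in>space M. \<not> \<phi> x} = 0) \<longleftrightarrow> V {x\<in>space M. \<not> \<phi> x} = 0"
    using V_attained[OF S] measure_le_V[OF _ S] by (fastforce intro: antisym)
  ultimately show ?thesis by simp
qed

lemma V_as_iff:
  assumes [measurable]: "Measurable.pred M \<phi>"
  shows "V_as M V \<phi> \<longleftrightarrow> (\<forall>P\<in>\<Lambda>. AE x in P. \<phi> x)"
proof
  assume "V_as M V \<phi>"
  then obtain A where A: "A \<in> sets M" "V (space M - A) = 0" "\<And>x. x \<in> A \<Longrightarrow> \<phi> x"
    by (auto simp: V_as_def)
  have "V {x\<in>space M. \<not> \<phi> x} \<le> V (space M - A)"
    using A by (intro V_mono) auto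
  moreover have "0 \<le> V {x\<in>space M. \<not> \<phi> x}" by (intro V_nonneg) measurable
  ultimately show "\<forall>P\<in>\<Lambda>. AE x in P. \<phi> x" using A by (simp add: qs_iff)
next
  assume "\<forall>P\<in>\<Lambda>. AE x in P. \<phi> x"
  then have "V (space M - {x\<in>space M. \<phi> x}) = 0"
    by (simp add: qs_iff set_diff_eq cong: conj_cong)
  moreover have "{x\<in>space M. \<phi> x} \<in> sets M" by measurable
  ultimately show "V_as M V \<phi>" unfolding V_as_def by blast
qed

text \<open>Invariance is known for \<open>V\<close>, not for single members of
  \<open>\<Lambda>\<close>. The exceptional set is therefore pulled back as a \<open>V\<close>-null
  set and only then returned to each \<open>P\<close>.\<close>

lemma qs_iter:
  assumes [measurable]: "Measurable.pred M \<phi>"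
    and \<phi>: "\<And>P. P \<in> \<Lambda> \<Longrightarrow> AE x in P. \<phi> x" and P: "P \<in> \<Lambda>"
  shows "AE x in P. \<forall>i. \<phi> ((T ^^ i) x)"
proof -
  have "\<forall>P\<in>\<Lambda>. AE x in P. \<phi> ((T ^^ i) x)" for i
  proof -
    have S: "{x\<in>space M. \<not> \<phi> x} \<in> sets M" by measurable
    have eq: "(T ^^ i) -` {x\<in>space M. \<not> \<phi> x} \<inter> space M = {x\<in>space M. \<not> \<phi> ((T ^^ i) x)}"
      using iter_space by auto
    have "V {x\<in>space M. \<not> \<phi> x} = 0"
      using \<phi> qs_iff[OF assms(1)] by blast
    with V_iter[OF S, of i] have "V {x\<in>space M. \<not> \<phi> ((T ^^ i) x)} = 0"
      unfolding eq by simp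
    then show ?thesis by (subst qs_iff) auto
  qed
  then show ?thesis using P by (subst AE_all_countable) blast
qed

section \<open>Wandering sets and invariant functions\<close>

text \<open>An orbit meets \<open>W\<close> at most once, so the sets \<open>A n\<close> of points
  that visit \<open>W\<close> at time \<open>n\<close> or later decrease to the empty set. Each
  contains the \<open>n\<close>-th preimage of \<open>W\<close>, whose capacity is
  \<open>V W\<close>.\<close>

lemma V_wandering:
  assumes W: "W \<in> sets M"
    and disj: "\<And>x i j. x \<in> space M \<Longrightarrow> i < j \<Longrightarrow> (T ^^ i) x \<in> W \<Longrightarrow> (T ^^ j) x \<notin> W"
  shows "V W = 0"
proof -
  define A where "A n = {x\<in>space M. \<exists>m\<ge>n. (T ^^ m) x \<in> W}" for n
  note W [measurable]
  have [measurable]: "A n \<in> sets M" for n unfolding A_def by measurable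
  have "(\<lambda>n. V (A n)) \<longlonglongrightarrow> 0"
  proof (rule V_decseq_tendsto_0)
    show "decseq A" by (auto simp: decseq_def A_def intro: order_trans)
    show "(\<Inter>n. A n) = {}"
    proof safe
      fix x assume "x \<in> (\<Inter>n. A n)"
      then have x: "x \<in> space M" "\<And>n. \<exists>m\<ge>n. (T ^^ m) x \<in> W" by (auto simp: A_def)
      obtain i where i: "(T ^^ i) x \<in> W" using x(2) by blast
      obtain j where "j \<ge> Suc i" "(T ^^ j) x \<in> W" using x(2) by blast
      with disj[OF x(1) _ i, of j] show "x \<in> {}" by simp
    qed
  qed simp
  moreover have "V W \<le> V (A n)" for n
  proof -
    have "V ((T ^^ n) -` W \<inter> space M) \<le> V (A n)"
      by (intro V_mono) (auto simp: A_def)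
    then show ?thesis using V_iter[OF W] by simp
  qed
  ultimately have "V W \<le> 0" by (auto intro: LIMSEQ_le_const)
  with V_nonneg[OF W] show ?thesis by simp
qed

text \<open>Along an orbit on which \<open>h\<close> is nondecreasing, a given rational level is
  crossed at most once. The crossing points thus form a wandering set, and countably many levels
  detect every strict increase.\<close>

lemma qs_invariant_of_le:
  fixes h :: "'a \<Rightarrow> real"
  assumes [measurable]: "h \<in> borel_measurable M"
    and le: "\<And>P. P \<in> \<Lambda> \<Longrightarrow> AE x in P. h x \<le> h (T x)" and P: "P \<in> \<Lambda>"
  shows "AE x in P. \<forall>i. h ((T ^^ i) x) = h x"
proof -
  \<comment> \<open>Monotonicity along the whole orbit is part of the wandering set, because
    wandering is required at every point and not just quasi-surely.\<close>
  define G where "G x \<longleftrightarrow> (\<forall>i. h ((T ^^ i) x) \<le> h ((T ^^ Suc i) x))" for x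
  have [measurable]: "Measurable.pred M G" unfolding G_def by measurable
  have G: "AE x in P. G x" if "P \<in> \<Lambda>" for P
    using qs_iter[OF _ le that] unfolding G_def by simp
  have G_mono: "h x \<le> h ((T ^^ n) x)" if "G x" for x n
    using that by (induction n) (auto simp: G_def intro: order_trans)
  have "\<forall>P\<in>\<Lambda>. AE x in P. \<not> (G x \<and> h x \<le> of_rat q \<and> of_rat q < h (T x))" for q
  proof -
    define W where "W = {x\<in>space M. G x \<and> h x \<le> of_rat q \<and> of_rat q < h (T x)}"
    have "V W = 0"
    proof (rule V_wandering)
      show "W \<in> sets M" unfolding W_def by measurable
      fix x i j assume x: "x \<in> space M" "i < j" "(T ^^ i) x \<in> W"
      define y where "y = (T ^^ i) x"
      have "G y" using x(3) by (simp add: W_def y_def)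
      then have "G (T y)" unfolding G_def
        by (metis funpow_Suc_right comp_apply)
      then have "h (T y) \<le> h ((T ^^ (j - Suc i)) (T y))" by (rule G_mono)
      also have "(T ^^ (j - Suc i)) (T y) = (T ^^ ((j - Suc i) + Suc i)) x"
        unfolding funpow_add y_def by simp
      also have "\<dots> = (T ^^ j) x" using x by simp
      finally show "(T ^^ j) x \<notin> W" using x(3) by (auto simp: W_def y_def)
    qed
    then show ?thesis by (subst qs_iff) (auto simp: W_def conj_ac)
  qed
  then have *: "AE x in P. \<forall>q. \<not> (G x \<and> h x \<le> of_rat q \<and> of_rat q < h (T x))" if "P \<in> \<Lambda>" for P
    using that by (subst AE_all_countable) blast
  have "AE x in P. h (T x) = h x" if "P \<in> \<Lambda>" for P
    using *[OF that] G[OF that]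
  proof eventually_elim
    case (elim x)
    have "h x \<le> h (T x)" using elim(2) G_mono[of x 1] by simp
    moreover have "\<not> h x < h (T x)"
      using elim of_rat_dense[of "h x" "h (T x)"] by (metis less_imp_le)
    ultimately show ?case by simp
  qed
  from qs_iter[OF _ this P] have "AE x in P. \<forall>i. h (T ((T ^^ i) x)) = h ((T ^^ i) x)"
    by simp
  then show ?thesis
  proof eventually_elim
    case (elim x)
    have "h ((T ^^ i) x) = h x" for i
      by (induction i) (use elim in auto)
    then show ?case by blast
  qed
qed

section \<open>Visit frequencies and the maximal inequality\<close>

definition visits :: "'a set \<Rightarrow> nat \<Rightarrow> 'a \<Rightarrow> real" where
  "visits A n x = (\<Sum>j<n. indicator A ((T ^^ j) x))"

text \<open>
  Quantifying over all \<open>i\<close> makes the set below forward invariant, so that it can stand in for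
  the set where the upper frequency of visits exceeds \<open>\<delta>\<close>.
\<close>

definition frequent :: "'a set \<Rightarrow> real \<Rightarrow> 'a set" where
  "frequent A \<delta> = {x\<in>space M. \<forall>i. \<exists>n\<ge>1. \<delta> * real n < visits A n ((T ^^ i) x)}"

lemma visits_measurable [measurable]: "A \<in> sets M \<Longrightarrow> visits A n \<in> borel_measurable M"
  unfolding visits_def
  by (intro borel_measurable_sum measurable_compose[OF iter_measurable]) auto

lemma frequent_measurable [measurable]:
  assumes "A \<in> sets M"
  shows "frequent A \<delta> \<in> sets M"
proof -
  have [measurable]: "(\<lambda>x. visits A n ((T ^^ i) x)) \<in> borel_measurable M" for n i
    by (rule measurable_compose[OF iter_measurable visits_measurable[OF assms]])
  show ?thesis unfolding frequent_def by measurable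
qed

lemma visits_nonneg: "0 \<le> visits A n x"
  by (simp add: visits_def sum_nonneg)

lemma visits_add: "visits A (n + k) x = visits A n x + visits A k ((T ^^ n) x)"
proof (induction k)
  case (Suc k)
  then show ?case
    by (simp add: visits_def funpow_add[symmetric] add.commute[of k n] flip: comp_apply[of "T ^^ k" "T ^^ n"])
qed (simp add: visits_def)

text \<open>The orbit of a point of \<open>D\<close> is covered by blocks with visit frequency above
  \<open>\<delta>\<close>. The resulting pointwise bound is integrated under \<open>P\<close>,
  divided by \<open>n\<close>, and passed to the limit.\<close>

lemma maximal_inequality:
  assumes A [measurable]: "A \<in> sets M" and P: "P \<in> \<Lambda>" and \<delta>: "\<delta> \<ge> 0"
  shows "\<delta> * measure P (frequent A \<delta>) \<le> V A"
proof -
  interpret prob_space P using P \<Lambda>_prob_space by blast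
  have [measurable_cong]: "sets P = sets M" using sets_\<Lambda>[OF P] .
  \<comment> \<open>The bound \<open>P (B') \<le> V B' = V B\<close> for each preimage
    \<open>B'\<close> of \<open>B\<close> takes the place of invariance of \<open>P\<close>.\<close>
  have int_visits: "integrable P (visits B n)" "(\<integral>x. visits B n x \<partial>P) \<le> real n * V B"
    if B [measurable]: "B \<in> sets M" for B n
  proof -
    have eq: "indicator B ((T ^^ j) x) = (indicator ((T ^^ j) -` B \<inter> space M) x :: real)"
      if "x \<in> space P" for x j
      using that space_\<Lambda>[OF P] by (auto simp: indicator_def)
    have S: "(T ^^ j) -` B \<inter> space M \<in> sets P" for j
      unfolding sets_\<Lambda>[OF P] by (rule measurable_sets[OF iter_measurable B])
    have i: "integrable P (\<lambda>x. indicator B ((T ^^ j) x) :: real)" for j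
      using S by (subst Bochner_Integration.integrable_cong[OF refl eq]) (auto simp: integrable_indicator_iff less_top[symmetric])
    then show "integrable P (visits B n)" unfolding visits_def by simp
    have "(\<integral>x. indicator B ((T ^^ j) x) \<partial>P) \<le> V B" for j
    proof -
      have "(\<integral>x. indicator B ((T ^^ j) x) \<partial>P) = measure P ((T ^^ j) -` B \<inter> space M)"
        using S[of j] space_\<Lambda>[OF P]
        by (subst Bochner_Integration.integral_cong[OF refl eq]) auto
      also have "\<dots> \<le> V ((T ^^ j) -` B \<inter> space M)"
        using S sets_\<Lambda>[OF P] by (intro measure_le_V P) auto
      finally show ?thesis using V_iter[OF B] by simp
    qed
    then have "(\<Sum>j<n. \<integral>x. indicator B ((T ^^ j) x) \<partial>P) \<le> (\<Sum>j<n. V B)"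
      by (intro sum_mono)
    then show "(\<integral>x. visits B n x \<partial>P) \<le> real n * V B"
      unfolding visits_def using i by simp
  qed
  define D where "D = frequent A \<delta>"
  \<comment> \<open>Points of \<open>D\<close> whose first block is longer than \<open>R\<close> are
    declared bad. This keeps block lengths bounded, so that the end of the covering costs only
    \<open>\<delta> * R\<close>.\<close>
  define E where "E R = {x\<in>D. \<forall>n\<in>{1..R}. \<not> \<delta> * real n < visits A n x}" for R
  have [measurable]: "D \<in> sets M" unfolding D_def by measurable
  have D_sub: "D \<subseteq> space M" by (auto simp: D_def frequent_def)
  have "E R = {x\<in>space M. x \<in> D \<and> (\<forall>n\<in>{1..R}. \<not> \<delta> * real n < visits A n x)}" for R
    using D_sub by (auto simp: E_def)
  then have [measurable]: "E R \<in> sets M" for R by simp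
  have D_iter: "(T ^^ i) x \<in> D" if "x \<in> D" for x i
    using that iter_space unfolding D_def frequent_def
    by (auto simp flip: funpow_add comp_apply[of "T ^^ _" "T ^^ i"])
  have E0: "(\<lambda>R. V (E R)) \<longlonglongrightarrow> 0"
  proof (rule V_decseq_tendsto_0)
    show "decseq E" by (force simp: decseq_def E_def)
    show "(\<Inter>R. E R) = {}"
    proof safe
      fix x assume x: "x \<in> (\<Inter>R. E R)"
      then have "x \<in> D" by (auto simp: E_def)
      then obtain n where "n \<ge> 1" "\<delta> * real n < visits A n ((T ^^ 0) x)"
        unfolding D_def frequent_def by blast
      moreover have "x \<in> E n" using x by blast
      ultimately show "x \<in> {}" by (auto simp: E_def)
    qed
  qed simp
  have main: "\<delta> * real n * indicator D x \<le> visits A n x + \<delta> * visits (E R) n x + \<delta> * real R"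
    for n R x
  proof (cases "x \<in> D")
    case True
    \<comment> \<open>The covering lemma is applied to the negated visit count, which is additive
      and at most 0, with \<open>c = - \<delta>\<close>, \<open>K = \<delta>\<close> and the
      indicator of \<open>E R\<close> as \<open>b\<close>. The orbit stays in \<open>D\<close>, so
      every position outside \<open>E R\<close> is good.\<close>
    have "- visits A n ((T ^^ 0) x) \<le> - \<delta> * real n
        + \<delta> * (\<Sum>j<n. indicator (E R) ((T ^^ (0 + j)) x)) + \<delta> * real R"
    proof (rule subadditive_covering[where lam = 0])
      fix i assume "indicator (E R) ((T ^^ i) x) < (1::real)"
      then have "(T ^^ i) x \<notin> E R" by auto
      then show "\<exists>m\<in>{1..R}. - visits A m ((T ^^ i) x) \<le> - \<delta> * real m"
        using D_iter[OF True, of i] by (force simp: E_def)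
    next
      show "- visits A (n + k) ((T ^^ i) x) \<le> - visits A n ((T ^^ i) x) + - visits A k ((T ^^ (i + n)) x)"
        for i n k by (simp add: visits_add funpow_add add.commute[of i])
    qed (use \<delta> in \<open>auto simp: visits_nonneg\<close>)
    then show ?thesis using True by (simp add: visits_def)
  next
    case False
    then show ?thesis using \<delta> by (simp add: visits_nonneg)
  qed
  have int: "\<delta> * real n * measure P D \<le> real n * V A + \<delta> * (real n * V (E R)) + \<delta> * real R" for n R
  proof -
    have "\<delta> * real n * measure P D = (\<integral>x. \<delta> * real n * indicator D x \<partial>P)"
      using D_sub space_\<Lambda>[OF P] by (simp add: Int_absorb2)
    also have "\<dots> \<le> (\<integral>x. visits A n x + \<delta> * visits (E R) n x + \<delta> * real R \<partial>P)"
    proof (rule integral_mono)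
      show "integrable P (\<lambda>x. \<delta> * real n * indicator D x)"
        by (intro integrable_mult_right) (auto simp: integrable_indicator_iff less_top[symmetric])
      show "integrable P (\<lambda>x. visits A n x + \<delta> * visits (E R) n x + \<delta> * real R)"
        by (intro Bochner_Integration.integrable_add integrable_mult_right int_visits integrable_const)
          measurable
    qed (rule main)
    also have "\<dots> = (\<integral>x. visits A n x \<partial>P) + \<delta> * (\<integral>x. visits (E R) n x \<partial>P) + \<delta> * real R"
      using int_visits by (simp add: prob_space)
    also have "\<dots> \<le> real n * V A + \<delta> * (real n * V (E R)) + \<delta> * real R"
      using int_visits \<delta> by (intro add_mono mult_left_mono) auto
    finally show ?thesis .
  qed
  have fin: "\<delta> * measure P D \<le> V A + \<delta> * V (E R) + \<delta> * real R / real n" if "n \<ge> 1" for n R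
  proof -
    have "real n * (\<delta> * measure P D) \<le> real n * (V A + \<delta> * V (E R) + \<delta> * real R / real n)"
      using int[of n R] that by (simp add: algebra_simps)
    then show ?thesis using that by (simp del: distrib_left)
  qed
  \<comment> \<open>The limit in \<open>n\<close> comes first, with \<open>R\<close> fixed, to
    remove \<open>\<delta> * R / n\<close>; then \<open>R\<close> tends to infinity.\<close>
  have "\<delta> * measure P D \<le> V A + \<delta> * V (E R)" for R
  proof -
    have "(\<lambda>n. V A + \<delta> * V (E R) + \<delta> * real R / real n) \<longlonglongrightarrow> V A + \<delta> * V (E R) + 0"
      by (intro tendsto_intros lim_const_over_n)
    then show ?thesis using fin by (intro LIMSEQ_le_const) auto
  qed
  moreover have "(\<lambda>R. V A + \<delta> * V (E R)) \<longlonglongrightarrow> V A + \<delta> * 0"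
    by (intro tendsto_intros E0)
  ultimately show ?thesis unfolding D_def by (intro LIMSEQ_le_const) auto
qed

text \<open>From some time \<open>i\<close> on, no initial frequency of the shifted orbit exceeds
  \<open>\<delta>\<close>, and the first \<open>i\<close> steps contribute at most \<open>i\<close>
  visits.\<close>

lemma visits_le_of_not_frequent:
  assumes "x \<in> space M" "x \<notin> frequent A \<delta>" "\<delta> \<ge> 0"
  shows "\<exists>i. \<forall>n. visits A n x \<le> real i + \<delta> * real n"
proof -
  obtain i where i: "\<And>n. n \<ge> 1 \<Longrightarrow> visits A n ((T ^^ i) x) \<le> \<delta> * real n"
    using assms by (force simp: frequent_def not_less)
  have "visits A n x \<le> real i + \<delta> * real n" for n
  proof -
    have "visits A n x \<le> visits A (i + n) x"
      unfolding visits_def by (intro sum_mono2) auto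
    also have "\<dots> = visits A i x + visits A n ((T ^^ i) x)" by (rule visits_add)
    also have "visits A i x \<le> real i"
      unfolding visits_def using sum_bounded_above[of "{..<i}" "\<lambda>j. indicator A ((T ^^ j) x)" "1::real"]
      by (simp add: indicator_le_1)
    also have "visits A n ((T ^^ i) x) \<le> \<delta> * real n"
      using i[of n] by (cases n) (auto simp: visits_def)
    finally show ?thesis by simp
  qed
  then show ?thesis by blast
qed

lemma qs_not_frequent:
  assumes A: "\<And>L. A L \<in> sets M" "decseq A" "(\<Inter>L. A L) = {}" and P: "P \<in> \<Lambda>" and \<delta>: "\<delta> > 0"
  shows "AE x in P. \<exists>L. x \<notin> frequent (A L) \<delta>"
proof -
  interpret prob_space P using P \<Lambda>_prob_space by blast
  note A(1) [measurable]
  define N where "N = (\<Inter>L. frequent (A L) \<delta>)"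
  have N: "N \<in> sets P" unfolding N_def sets_\<Lambda>[OF P] by measurable
  have "\<delta> * measure P N \<le> V (A L)" for L
  proof -
    have "measure P N \<le> measure P (frequent (A L) \<delta>)"
      using sets_\<Lambda>[OF P] by (intro finite_measure_mono) (auto simp: N_def)
    then have "\<delta> * measure P N \<le> \<delta> * measure P (frequent (A L) \<delta>)" using \<delta> by simp
    also have "\<dots> \<le> V (A L)" using \<delta> P by (intro maximal_inequality A) auto
    finally show ?thesis .
  qed
  with V_decseq_tendsto_0[OF A] have "\<delta> * measure P N \<le> 0"
    by (intro LIMSEQ_le_const) auto
  then have "measure P N = 0"
    using \<delta> measure_nonneg[of P N] by (auto simp: mult_le_0_iff)
  then have "N \<in> null_sets P" using N by (auto simp: emeasure_eq_measure)
  then have "AE x in P. x \<notin> N" by (rule AE_not_in)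
  then show ?thesis by (auto simp: N_def)
qed

section \<open>Quasi-sure convergence of subadditive sequences\<close>

lemma qs_subadditive_convergence:
  fixes f :: "nat \<Rightarrow> 'a \<Rightarrow> real"
  assumes f_meas [measurable]: "\<And>n. f n \<in> borel_measurable M"
    and bnd: "\<And>n x. x \<in> space M \<Longrightarrow> \<bar>f n x\<bar> \<le> lam * real n"
    and sub: "\<And>n k P. P \<in> \<Lambda> \<Longrightarrow> AE x in P. f (n + k) x \<le> f n x + f k ((T ^^ n) x)"
  shows "\<exists>h \<in> borel_measurable M. (\<forall>x\<in>space M. \<bar>h x\<bar> \<le> lam) \<and>
    (\<forall>P\<in>\<Lambda>. AE x in P. (\<forall>i. h ((T ^^ i) x) = h x) \<and> (\<lambda>n. f n x / real n) \<longlonglongrightarrow> h x)"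
proof (cases "space M = {}")
  case True
  then show ?thesis using space_\<Lambda> by (intro bexI[of _ "\<lambda>_. 0"]) auto
next
  case False
  then have lam: "lam \<ge> 0" using bnd[of _ 1] by fastforce
  define u where "u x n = f n x / real n" for x n
  define h where "h x = real_liminf (u x)" for x
  have [measurable]: "(\<lambda>x. u x n) \<in> borel_measurable M" for n unfolding u_def by measurable
  have h_meas [measurable]: "h \<in> borel_measurable M" unfolding h_def by measurable
  have u_bnd: "\<bar>u x n\<bar> \<le> lam" if "x \<in> space M" for x n
    using bnd[OF that, of n] lam by (cases "n = 0") (auto simp: u_def divide_simps)
  have h_bnd: "\<bar>h x\<bar> \<le> lam" if "x \<in> space M" for x
    unfolding h_def using u_bnd[OF that] by (rule ereal_real_liminf(2))

  have sub_all: "AE x in P. \<forall>i. \<forall>n k. f (n + k) ((T ^^ i) x) \<le> f n ((T ^^ i) x) + f k ((T ^^ n) ((T ^^ i) x))"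
    if "P \<in> \<Lambda>" for P
  proof (rule qs_iter[OF _ _ that])
    show "Measurable.pred M (\<lambda>x. \<forall>n k. f (n + k) x \<le> f n x + f k ((T ^^ n) x))" by measurable
    show "AE x in P. \<forall>n k. f (n + k) x \<le> f n x + f k ((T ^^ n) x)" if "P \<in> \<Lambda>" for P
      using sub[OF that] by (simp add: AE_all_countable)
  qed

  have h_le: "AE x in P. h x \<le> h (T x)" if "P \<in> \<Lambda>" for P
    using sub_all[OF that] AE_space
  proof eventually_elim
    case (elim x)
    have x: "x \<in> space M" using elim space_\<Lambda>[OF that] by simp
    then have Tx: "T x \<in> space M" by (rule measurable_space[OF T_meas])
    \<comment> \<open>One \<open>lam\<close> bounds \<open>f 1 x\<close>; the other pays for
      replacing the denominator \<open>n + 1\<close> by \<open>n\<close>. At \<open>n = 0\<close>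
      division by zero makes \<open>u (T x) 0\<close> equal to 0.\<close>
    have step: "u x (Suc n) \<le> u (T x) n + 2 * lam * inverse (real (Suc n))" for n
    proof (cases "n = 0")
      case True
      then show ?thesis using bnd[OF x, of 1] lam by (simp add: u_def)
    next
      case False
      have "f (1 + n) x \<le> f 1 x + f n ((T ^^ 1) x)"
        using elim(1)[rule_format, of 1 n 0] by simp
      also have "f 1 x \<le> lam" using bnd[OF x, of 1] by simp
      finally have "f (Suc n) x \<le> lam + f n (T x)" by simp
      moreover have "- (lam * real n) \<le> f n (T x)" using bnd[OF Tx, of n] by simp
      then have "f n (T x) \<le> f n (T x) / real n * real (Suc n) + lam"
        using False by (simp add: field_simps)
      ultimately have "f (Suc n) x \<le> f n (T x) / real n * real (Suc n) + 2 * lam" by simp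
      then show ?thesis unfolding u_def by (simp add: divide_simps)
    qed
    have "(\<lambda>n. 2 * lam * inverse (real (Suc n))) \<longlonglongrightarrow> 2 * lam * 0"
      by (intro tendsto_intros LIMSEQ_inverse_real_of_nat)
    then show ?case unfolding h_def
      using u_bnd[OF x] u_bnd[OF Tx] step by (intro real_liminf_le_of_null_diff) auto
  qed
  have h_inv: "AE x in P. \<forall>i. h ((T ^^ i) x) = h x" if "P \<in> \<Lambda>" for P
    by (rule qs_invariant_of_le[OF h_meas h_le that])

  \<comment> \<open>The number \<open>e k\<close> serves both as the slack above \<open>h\<close>
    and as the admissible frequency of bad positions. A sequence of values lets the exceptional null
    sets be united.\<close>
  define e :: "nat \<Rightarrow> real" where "e k = inverse (real (Suc k))" for k
  have e_pos: "e k > 0" for k by (simp add: e_def)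
  define A where "A k L = {x\<in>space M. \<forall>m\<in>{1..L}. \<not> f m x \<le> (h x + e k) * real m}" for k L
  have A_meas [measurable]: "A k L \<in> sets M" for k L unfolding A_def by measurable
  have A_dec: "decseq (A k)" for k by (force simp: decseq_def A_def)
  have A_empty: "(\<Inter>L. A k L) = {}" for k
  proof safe
    fix x assume x: "x \<in> (\<Inter>L. A k L)"
    then have "x \<in> space M" by (auto simp: A_def)
    then have "\<exists>n\<ge>1. u x n < h x + e k"
      unfolding h_def by (intro frequently_less_real_liminf[where C = lam] u_bnd e_pos)
    then obtain n where n: "n \<ge> 1" "u x n < h x + e k" by auto
    then have "f n x \<le> (h x + e k) * real n" by (simp add: u_def field_simps)
    moreover have "x \<in> A k n" using x by blast
    ultimately show "x \<in> {}" using n by (auto simp: A_def)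
  qed
  have not_freq: "AE x in P. \<forall>k. \<exists>L. x \<notin> frequent (A k L) (e k)" if "P \<in> \<Lambda>" for P
    using qs_not_frequent[OF A_meas A_dec A_empty that e_pos] by (simp add: AE_all_countable)

  have conv: "AE x in P. (\<lambda>n. u x n) \<longlonglongrightarrow> h x" if "P \<in> \<Lambda>" for P
    using sub_all[OF that] h_inv[OF that] not_freq[OF that] AE_space
  proof eventually_elim
    case (elim x)
    have x: "x \<in> space M" using elim space_\<Lambda>[OF that] by simp
    \<comment> \<open>Since \<open>h x \<ge> - lam\<close>, the excess cost
      \<open>lam - (h x + e k)\<close> of a bad step stays below this \<open>K\<close>, uniformly in
      \<open>k\<close>.\<close>
    define K where "K = 2 * lam + 1"
    have upper: "\<exists>C. \<forall>n\<ge>1. u x n \<le> h x + e k + K * e k + C / real n" for k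
    proof -
      obtain L where L: "x \<notin> frequent (A k L) (e k)" using elim by blast
      then obtain i where i: "\<And>n. visits (A k L) n x \<le> real i + e k * real n"
        using visits_le_of_not_frequent[OF x L] e_pos[of k] by auto
      \<comment> \<open>Constancy of \<open>h\<close> along the orbit allows one constant
        \<open>c = h x + e k\<close> at all positions: outside \<open>A k L\<close> a good block
        exists relative to the value of \<open>h\<close> at that position.\<close>
      have cov: "f n ((T ^^ 0) x) \<le> (h x + e k) * real n
          + K * (\<Sum>j<n. indicator (A k L) ((T ^^ (0 + j)) x)) + K * real L" for n
      proof (rule subadditive_covering[where lam = lam])
        show "f (n + k) ((T ^^ i) x) \<le> f n ((T ^^ i) x) + f k ((T ^^ (i + n)) x)" for i n k
          using elim(1) by (simp add: funpow_add add.commute[of i])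
        show "f n ((T ^^ i) x) \<le> lam * real n" for i n
          using bnd[OF iter_space[OF x], of n i] by simp
        show "lam - (h x + e k) \<le> K" using h_bnd[OF x] e_pos[of k] by (auto simp: K_def)
        show "\<exists>m\<in>{1..L}. f m ((T ^^ i) x) \<le> (h x + e k) * real m"
          if "indicator (A k L) ((T ^^ i) x) < (1::real)" for i
        proof -
          have "(T ^^ i) x \<notin> A k L" using that by auto
          then show ?thesis using iter_space[OF x] elim(2) by (auto simp: A_def)
        qed
      qed (use lam in \<open>auto simp: K_def\<close>)
      have "u x n \<le> h x + e k + K * e k + (K * real i + K * real L) / real n" if "n \<ge> 1" for n
      proof -
        have "f n x \<le> (h x + e k) * real n + K * visits (A k L) n x + K * real L"
          using cov[of n] by (simp add: visits_def)
        also have "K * visits (A k L) n x \<le> K * (real i + e k * real n)"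
          using lam by (intro mult_left_mono i) (simp add: K_def)
        finally show ?thesis using that by (simp add: u_def field_simps)
      qed
      then show ?thesis by blast
    qed
    show ?case
    proof (rule LIMSEQ_I)
      fix r :: real assume r: "r > 0"
      have "(\<lambda>k. e k + K * e k) \<longlonglongrightarrow> 0 + K * 0"
        unfolding e_def by (intro tendsto_intros LIMSEQ_inverse_real_of_nat)
      then have "eventually (\<lambda>k. e k + K * e k < r / 2) sequentially"
        using r by (intro order_tendstoD) auto
      then obtain k where k: "e k + K * e k < r / 2" by (auto simp: eventually_sequentially)
      obtain C where C: "\<And>n. n \<ge> 1 \<Longrightarrow> u x n \<le> h x + e k + K * e k + C / real n"
        using upper by blast
      have "eventually (\<lambda>n. C / real n < r / 2) sequentially"
        using r by (intro order_tendstoD[OF lim_const_over_n]) auto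
      moreover have "eventually (\<lambda>n. h x - r < u x n) sequentially"
        unfolding h_def by (rule eventually_gt_real_liminf[OF u_bnd[OF x] r])
      ultimately have "eventually (\<lambda>n. norm (u x n - h x) < r) sequentially"
        using eventually_ge_at_top[of 1]
      proof eventually_elim
        case (elim n)
        then have "u x n - h x < r" using C[of n] k by linarith
        with elim show ?case by (simp add: abs_less_iff)
      qed
      then show "\<exists>no. \<forall>n\<ge>no. norm (u x n - h x) < r" by (simp add: eventually_sequentially)
    qed
  qed
  show ?thesis
    using h_bnd h_inv conv by (intro bexI[of _ h]) (auto simp: u_def)
qed

section \<open>Strictly invariant limits and ergodicity\<close>

text \<open>Moving the starting point by \<open>T\<close> shifts the sequence by one, which leaves
  the lower limit unchanged at every point. This turns quasi-sure invariance of \<open>h\<close>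
  into exact invariance of level sets.\<close>

lemma inv_measurable_liminf_iter:
  assumes [measurable]: "h \<in> borel_measurable M"
  shows "inv_measurable M T (\<lambda>x. real_liminf (\<lambda>n. h ((T ^^ n) x)))" (is "inv_measurable M T ?g")
proof -
  have g_meas: "?g \<in> borel_measurable M" by measurable
  have g_inv: "?g (T x) = ?g x" for x
    using real_liminf_Suc[of "\<lambda>n. h ((T ^^ n) x)"] by (simp add: funpow_swap1)
  have "T -` (?g -` B \<inter> space M) \<inter> space M = ?g -` B \<inter> space M" for B
    using g_inv measurable_space[OF T_meas] by auto
  then show ?thesis
    unfolding inv_measurable_def inv_sets_def using measurable_sets[OF g_meas] by auto
qed

text \<open>The constant is the \<open>V\<close>-essential supremum of \<open>g\<close>. Below it
  the sets \<open>U q\<close> have positive capacity, so ergodicity makes their complements null and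
  the same number is an essential lower bound.\<close>

lemma qs_constant_of_ergodic:
  assumes erg: "ergodic_cap M T V" and V1: "V (space M) = 1"
    and g: "inv_measurable M T g" and bnd: "\<And>x. x \<in> space M \<Longrightarrow> \<bar>g x\<bar> \<le> C"
  shows "\<exists>c. V_as M V (\<lambda>x. g x = c)"
proof -
  have [measurable]: "g \<in> borel_measurable M"
    using g by (auto simp: inv_measurable_def inv_sets_def intro!: measurableI)
  define U where "U q = {x\<in>space M. g x > q}" for q
  have U_meas [measurable]: "U q \<in> sets M" for q unfolding U_def by measurable
  have "g -` {q<..} \<inter> space M = U q" for q by (auto simp: U_def)
  then have U_inv: "U q \<in> inv_sets M T" for q
    using g by (metis inv_measurable_def borel_open open_greaterThan)
  have alt: "V (U q) = 0 \<or> V (space M - U q) = 0" for q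
    using erg U_inv by (auto simp: ergodic_cap_def)
  define S where "S = {q. V (U q) = 0}"
  have "V {} = 0" using V_attained[of "{}"] by auto
  moreover have "U C = {}" using bnd by (force simp: U_def)
  \<comment> \<open>This membership and the lower bound \<open>- C\<close> of \<open>S\<close> make
    \<open>Inf S\<close> meaningful.\<close>
  ultimately have "C \<in> S" by (simp add: S_def)
  have "\<not> q < - C" if "q \<in> S" for q
  proof
    assume "q < - C"
    then have "U q = space M" using bnd by (force simp: U_def)
    with that V1 show False by (simp add: S_def)
  qed
  then have bdd: "bdd_below S" by (intro bdd_belowI[of _ "- C"]) (simp add: not_less)
  define c where "c = Inf S"
  have up: "V (U q) = 0" if q: "q > c" for q
  proof -
    obtain p where p: "p \<in> S" "p < q"
      using q \<open>C \<in> S\<close> cInf_lessD[of S q] unfolding c_def by blast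
    have "V (U q) \<le> V (U p)" using p by (intro V_mono) (auto simp: U_def)
    then show ?thesis using p V_nonneg[OF U_meas, of q] by (simp add: S_def)
  qed
  have low: "V (space M - U q) = 0" if "q < c" for q
    using alt[of q] that cInf_lower[OF _ bdd, of q] by (force simp: S_def c_def)
  have "\<forall>P\<in>\<Lambda>. AE x in P. g x \<le> c + inverse (real (Suc n))" for n
    using up[of "c + inverse (real (Suc n))"] by (subst qs_iff) (auto simp: U_def not_le)
  moreover have "\<forall>P\<in>\<Lambda>. AE x in P. c - inverse (real (Suc n)) < g x" for n
    using low[of "c - inverse (real (Suc n))"]
    by (subst qs_iff) (auto simp: U_def set_diff_eq cong: conj_cong)
  ultimately have lim: "AE x in P. \<forall>n. g x \<le> c + inverse (real (Suc n)) \<and> c - inverse (real (Suc n)) < g x"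
    if "P \<in> \<Lambda>" for P using that by (simp add: AE_all_countable)
  have "AE x in P. g x = c" if "P \<in> \<Lambda>" for P
    using lim[OF that]
  proof eventually_elim
    case * : (elim x)
    have "(\<lambda>n. c + inverse (real (Suc n))) \<longlonglongrightarrow> c + 0" "(\<lambda>n. c - inverse (real (Suc n))) \<longlonglongrightarrow> c - 0"
      by (intro tendsto_intros LIMSEQ_inverse_real_of_nat)+
    then have "g x \<le> c" "c \<le> g x"
      using * by (auto intro: LIMSEQ_le_const LIMSEQ_le_const2 less_imp_le)
    then show "g x = c" by simp
  qed
  then show ?thesis by (subst V_as_iff) auto
qed

end

section \<open>The subadditive ergodic theorem for upper probabilities\<close>

theorem theorem7p1:
  fixes M :: "'a measure" and T :: "'a \<Rightarrow> 'a" and V :: "'a set \<Rightarrow> real"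
    and f :: "nat \<Rightarrow> 'a \<Rightarrow> real" and lam :: real
  assumes std: "standard_space M"
    and T_meas: "T \<in> M \<rightarrow>\<^sub>M M"
    and upper: "upper_probability M V"
    and inv: "T_invariant_cap M T V"
    and f_meas: "\<And>n. n \<ge> 1 \<Longrightarrow> f n \<in> borel_measurable M"
    and lam_pos: "lam > 0"
    and bnd: "\<And>n \<omega>. n \<ge> 1 \<Longrightarrow> \<omega> \<in> space M \<Longrightarrow>
                 - lam * real n \<le> f n \<omega> \<and> f n \<omega> \<le> lam * real n"
    and subadd: "\<And>n k. n \<ge> 1 \<Longrightarrow> k \<ge> 1 \<Longrightarrow>
                 V_as M V (\<lambda>\<omega>. f (n + k) \<omega> \<le> f n \<omega> + f k ((T ^^ n) \<omega>))"
  shows "\<exists>fs :: 'a \<Rightarrow> real.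
           inv_measurable M T fs \<and>
           (\<exists>C. \<forall>\<omega>\<in>space M. \<bar>fs \<omega>\<bar> \<le> C) \<and>
           V_as M V (\<lambda>\<omega>. (\<lambda>n. f n \<omega> / real n) \<longlonglongrightarrow> fs \<omega>) \<and>
           (ergodic_cap M T V \<longrightarrow> (\<exists>c. V_as M V (\<lambda>\<omega>. fs \<omega> = c)))"
proof -
  obtain \<Lambda> where \<Lambda>: "\<Lambda> \<subseteq> probs_on M" "setwise_compact M \<Lambda>"
    "\<And>A. A \<in> sets M \<Longrightarrow> \<exists>P\<in>\<Lambda>. measure P A = V A"
    "\<And>P A. P \<in> \<Lambda> \<Longrightarrow> A \<in> sets M \<Longrightarrow> measure P A \<le> V A"
    using upper unfolding upper_probability_def by blast
  interpret invariant_upper_probability M T V \<Lambda>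
    using T_meas \<Lambda> inv by unfold_locales (auto simp: T_invariant_cap_def)
  have V1: "V (space M) = 1" using upper by (simp add: upper_probability_def capacity_def)
  \<comment> \<open>the hypotheses say nothing about \<open>f 0\<close>\<close>
  define f' where "f' n = (if n = 0 then (\<lambda>_. 0) else f n)" for n
  have f'_meas: "f' n \<in> borel_measurable M" for n using f_meas by (simp add: f'_def)
  have f'_bnd: "\<bar>f' n x\<bar> \<le> lam * real n" if "x \<in> space M" for n x
    using bnd[of n x] that by (auto simp: f'_def abs_le_iff)
  have f'_sub: "AE x in P. f' (n + k) x \<le> f' n x + f' k ((T ^^ n) x)" if "P \<in> \<Lambda>" for n k P
  proof (cases "n = 0 \<or> k = 0")
    case False
    have "Measurable.pred M (\<lambda>x. f' (n + k) x \<le> f' n x + f' k ((T ^^ n) x))"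
      using f'_meas by measurable
    moreover have "V_as M V (\<lambda>x. f' (n + k) x \<le> f' n x + f' k ((T ^^ n) x))"
      using subadd[of n k] False by (simp add: f'_def)
    ultimately show ?thesis using V_as_iff that by blast
  qed (auto simp: f'_def)
  obtain h where h [measurable]: "h \<in> borel_measurable M"
    and h_bnd: "\<And>x. x \<in> space M \<Longrightarrow> \<bar>h x\<bar> \<le> lam"
    and h: "\<And>P. P \<in> \<Lambda> \<Longrightarrow> AE x in P. (\<forall>i. h ((T ^^ i) x) = h x) \<and> (\<lambda>n. f' n x / real n) \<longlonglongrightarrow> h x"
    using qs_subadditive_convergence[OF f'_meas f'_bnd f'_sub] by auto
  \<comment> \<open>Where \<open>h\<close> is constant along the orbit this is the lower limit of a
    constant sequence, so \<open>fs\<close> agrees with \<open>h\<close> quasi-surely while being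
    invariant everywhere.\<close>
  define fs where "fs x = real_liminf (\<lambda>n. h ((T ^^ n) x))" for x
  have fs_inv: "inv_measurable M T fs"
    unfolding fs_def by (rule inv_measurable_liminf_iter) measurable
  have fs_bnd: "\<bar>fs x\<bar> \<le> lam" if "x \<in> space M" for x
    unfolding fs_def using h_bnd iter_space[OF that] by (intro ereal_real_liminf(2)) auto
  have f'_eq: "f' n x / real n = f n x / real n" for n x by (simp add: f'_def)
  have [measurable]: "fs \<in> borel_measurable M" unfolding fs_def by measurable
  have [measurable]: "(\<lambda>x. f n x / real n) \<in> borel_measurable M" for n
    using f'_meas[of n] unfolding f'_eq[symmetric] by measurable
  have "V_as M V (\<lambda>x. (\<lambda>n. f n x / real n) \<longlonglongrightarrow> fs x)"
  proof (subst V_as_iff)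
    show "Measurable.pred M (\<lambda>x. (\<lambda>n. f n x / real n) \<longlonglongrightarrow> fs x)"
      by measurable
    show "\<forall>P\<in>\<Lambda>. AE x in P. (\<lambda>n. f n x / real n) \<longlonglongrightarrow> fs x"
    proof
      fix P assume "P \<in> \<Lambda>"
      from h[OF this] show "AE x in P. (\<lambda>n. f n x / real n) \<longlonglongrightarrow> fs x"
        by eventually_elim (simp add: fs_def real_liminf_const f'_eq)
    qed
  qed
  with fs_inv fs_bnd qs_constant_of_ergodic[OF _ V1 fs_inv fs_bnd] show ?thesis by blast
qed

end
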